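(* For every $n>0$, the map $\Phi$ is a bijection from the set of ADI words of DI-sortable permutations of $[n]$ to the set of Schröder paths from $(0,0)$ to $(n-1,n-1)$.
   Context: A permutation $\pi=\pi_1\cdots\pi_n$ of $[n]$ is processed by a machine consisting of an input (initially $\pi_1,\dots,\pi_n$), a first stack, a second stack, and an output, with operations: $\mathsf{E}$ moves the next input entry onto the top of the first stack; $\mathsf{N}$ pops the top of the first stack and pushes it onto the second stack; $\mathsf{C}$ pops the top of the second stack to the output. A DI word of $\pi$ is a word over $\{\mathsf{E},\mathsf{N},\mathsf{C}\}$ whose operations are all legal when applied in order starting from $\pi$ in the input and empty stacks, whose final output is $12\cdots n$, and during which the first stack's entries always decrease from top to bottom and the second stack's entries always increase from top to bottom; $\pi$ is DI-sortable if it has a DI word. The ADI word of a DI-sortable $\pi$ is the word of operations performed by the following algorithm, which at each stage performs the first applicable step: (1) if the top entry of the second stack is the smallest value not yet output, perform $\mathsf{C}$; (2) if the first stack is nonempty and its $m$ entries are exactly the next $m$ values to be output, transfer all of them to the second stack by $m$ successive $\mathsf{N}$ operations; (3) otherwise, if the next input entry is smaller than the top of the second stack and larger than the top of the first stack (each comparison counting as satisfied if the corresponding stack is empty), perform $\mathsf{E}$; (4) otherwise perform $\mathsf{N}$. In an ADI word, every maximal block of consecutive $\mathsf{C}$'s is immediately preceded by $\mathsf{E}\mathsf{N}$. The map $\Phi$: given an ADI word $W$ with $k$ maximal blocks of consecutive $\mathsf{C}$'s of lengths $\tau_1,\dots,\tau_k$ (in order), set $\ell_i=\tau_1+\cdots+\tau_i$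 (so $\ell_k=n$). Form $T$ by replacing each substring $\mathsf{E}\mathsf{N}\mathsf{C}^{\tau_i}$ (a maximal block of $\mathsf{C}$'s together with the two letters preceding it) by a single $\mathsf{N}$. Form $S_{\mathsf{D}}$ from $T$ by replacing, for each $i\in[k]$, the $\ell_i$-th $\mathsf{N}$ of $T$ by $\mathsf{D}$; delete the final letter (a $\mathsf{D}$) of $S_{\mathsf{D}}$ to obtain $\Phi(W)$. A Schröder path from $(0,0)$ to $(m,m)$ is a word over $\{\mathsf{E},\mathsf{N},\mathsf{D}\}$ read as a lattice path with steps $\mathsf{E}=(1,0)$, $\mathsf{N}=(0,1)$, $\mathsf{D}=(1,1)$, starting at $(0,0)$, ending at $(m,m)$, and staying weakly below the line $y=x$ (for $m=0$, the empty path). *)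

theory Defs
  imports Main "HOL-Combinatorics.Multiset_Permutations"
begin

datatype letter = E | N | C | D

text \<open>
  A configuration is (input, first stack, second stack, output).  Both stacks are lists with the
  top at the head; the head of the input is the next entry to be read; the output is listed in the
  order in which it was produced.
\<close>

type_synonym config = "nat list \<times> nat list \<times> nat list \<times> nat list"

definition initial :: "nat list \<Rightarrow> config" where
  "initial p = (p, [], [], [])"

text \<open>The value \<open>None\<close> means that the operation is not legal.\<close>

fun exec :: "letter \<Rightarrow> config \<Rightarrow> config option" where
  "exec E (x # inp, s, t, out) = Some (inp, x # s, t, out)"
| "exec N (inp, x # s, t, out) = Some (inp, s, x # t, out)"
| "exec C (inp, s, x # t, out) = Some (inp, s, t, out @ [x])"
| "exec _ _ = None"

fun exec_word :: "letter list \<Rightarrow> config \<Rightarrow> config option" where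
  "exec_word [] c = Some c"
| "exec_word (a # w) c = Option.bind (exec a c) (exec_word w)"

fun di_config :: "config \<Rightarrow> bool" where
  "di_config (inp, s, t, out) \<longleftrightarrow> sorted_wrt (>) s \<and> sorted_wrt (<) t"

definition di_word :: "nat list \<Rightarrow> letter list \<Rightarrow> bool" where
  "di_word p w \<longleftrightarrow>
     (\<forall>k\<le>length w. \<exists>c. exec_word (take k w) (initial p) = Some c \<and> di_config c) \<and>
     (\<exists>inp s t. exec_word w (initial p) = Some (inp, s, t, [1..<Suc (length p)]))"

definition di_sortable :: "nat list \<Rightarrow> bool" where
  "di_sortable p \<longleftrightarrow> (\<exists>w. di_word p w)"

text \<open>The values not yet output, in increasing order, i.e. in the order they have to be output.\<close>

fun pending :: "config \<Rightarrow> nat list" where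
  "pending (inp, s, t, out) = sort (inp @ s @ t)"

text \<open>
  One stage may perform several operations: in the second case the whole first stack is transferred.
\<close>

fun adi_stage :: "config \<Rightarrow> letter list" where
  "adi_stage (inp, s, t, out) =
     (if t \<noteq> [] \<and> hd t = hd (pending (inp, s, t, out)) then [C]
      else if s \<noteq> [] \<and> set s = set (take (length s) (pending (inp, s, t, out)))
        then replicate (length s) N
      else if inp \<noteq> [] \<and> (t = [] \<or> hd inp < hd t) \<and> (s = [] \<or> hd inp > hd s) then [E]
      else [N])"

lemma adi_stage_nonempty: "adi_stage c \<noteq> []"
  by (cases c) (simp del: pending.simps)

fun potential :: "config \<Rightarrow> nat" where
  "potential (inp, s, t, out) = 3 * length inp + 2 * length s + length t"

lemma exec_potential: "exec a c = Some c' \<Longrightarrow> potential c' < potential c"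
  by (induction a c rule: exec.induct) auto

lemma exec_word_potential_le: "exec_word w c = Some c' \<Longrightarrow> potential c' \<le> potential c"
proof (induction w arbitrary: c)
  case (Cons a w)
  then obtain d where "exec a c = Some d" "exec_word w d = Some c'"
    by (auto simp: bind_eq_Some_conv)
  with Cons.IH[of d] exec_potential[of a c d] show ?case by linarith
qed simp

lemma exec_word_potential:
  assumes "exec_word w c = Some c'" "w \<noteq> []"
  shows "potential c' < potential c"
proof -
  obtain a v where w: "w = a # v" using assms(2) by (cases w) auto
  then obtain d where "exec a c = Some d" "exec_word v d = Some c'"
    using assms(1) by (auto simp: bind_eq_Some_conv)
  with exec_word_potential_le[of v d c'] exec_potential[of a c d] show ?thesis by linarith
qed

text \<open>
  The algorithm ends when nothing is pending any more.  As a convention that only serves to make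
  the function total, it also halts when the next stage asks for an illegal operation.
\<close>

function adi_from :: "config \<Rightarrow> letter list" where
  "adi_from c =
     (if pending c = [] then []
      else case exec_word (adi_stage c) c of
             None \<Rightarrow> []
           | Some c' \<Rightarrow> adi_stage c @ adi_from c')"
  by pat_completeness auto
termination
proof (relation "measure potential")
  fix c c' assume "exec_word (adi_stage c) c = Some c'"
  from exec_word_potential[OF this adi_stage_nonempty] show "(c', c) \<in> measure potential"
    by simp
qed simp

declare adi_from.simps [simp del]

definition adi_word :: "nat list \<Rightarrow> letter list" where
  "adi_word p = adi_from (initial p)"

definition adi_words :: "nat \<Rightarrow> letter list set" where
  "adi_words n = adi_word ` {p \<in> permutations_of_set {1..n}. di_sortable p}"

lemma length_dropWhile_less_Suc [termination_simp]:
  "length (dropWhile P w) < Suc (length w)"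
  "length (dropWhile P w) < Suc (Suc (Suc (length w)))"
  using length_dropWhile_le[of P w] by linarith+

text \<open>The lengths \<open>\<tau>\<^sub>1, \<dots>, \<tau>\<^sub>k\<close> of the maximal blocks of \<open>C\<close>'s.\<close>

fun C_blocks :: "letter list \<Rightarrow> nat list" where
  "C_blocks [] = []"
| "C_blocks (C # w) = Suc (length (takeWhile ((=) C) w)) # C_blocks (dropWhile ((=) C) w)"
| "C_blocks (a # w) = C_blocks w"

text \<open>The set of all \<open>l\<^sub>i = \<tau>\<^sub>1 + \<dots> + \<tau>\<^sub>i\<close> with \<open>1 \<le> i \<le> k\<close>.\<close>

definition block_ends :: "letter list \<Rightarrow> nat set" where
  "block_ends w = {sum_list (take i (C_blocks w)) | i. 1 \<le> i \<and> i \<le> length (C_blocks w)}"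

text \<open>Replace each \<open>E N C\<^bsup>\<tau>\<^esup>\<close>, with the block of \<open>C\<close>'s maximal and nonempty, by a single \<open>N\<close>.\<close>

fun contract :: "letter list \<Rightarrow> letter list" where
  "contract (E # N # C # w) = N # contract (dropWhile ((=) C) w)"
| "contract (a # w) = a # contract w"
| "contract [] = []"

text \<open>
  Replace by \<open>D\<close> every \<open>N\<close> whose rank among the \<open>N\<close>'s lies in \<open>L\<close>, where \<open>j\<close> is the rank of the
  next \<open>N\<close>.
\<close>

fun mark :: "nat set \<Rightarrow> nat \<Rightarrow> letter list \<Rightarrow> letter list" where
  "mark L j [] = []"
| "mark L j (a # w) =
     (if a = N then (if j \<in> L then D else N) # mark L (Suc j) w else a # mark L j w)"

definition Phi :: "letter list \<Rightarrow> letter list" where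
  "Phi w = butlast (mark (block_ends w) 1 (contract w))"

fun move :: "letter \<Rightarrow> nat \<times> nat \<Rightarrow> nat \<times> nat" where
  "move E (x, y) = (x + 1, y)"
| "move N (x, y) = (x, y + 1)"
| "move D (x, y) = (x + 1, y + 1)"
| "move C (x, y) = (x, y)" \<comment> \<open>not a step; excluded from paths below\<close>

definition endpoint :: "letter list \<Rightarrow> nat \<times> nat" where
  "endpoint w = fold move w (0, 0)"

definition schroeder_paths :: "nat \<Rightarrow> letter list set" where
  "schroeder_paths m =
     {w. set w \<subseteq> {E, N, D} \<and> endpoint w = (m, m) \<and>
         (\<forall>k\<le>length w. snd (endpoint (take k w)) \<le> fst (endpoint (take k w)))}"

end

theory Submission imports Defs begin

text \<open>
  The algorithm never leaves the set of sortable configurations: while the smallest pending value is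
  still in the input, any other operation would make it impossible for that value to leave first, and
  once it has entered a stack it can be output at once without harm.  It can only enter an empty
  first stack, so \<open>C\<close>'s only arise in groups \<open>E N C\<^sup>k\<close> that start with an empty first stack.  Conversely every legal word composed of such
  groups and of single \<open>E\<close>'s and \<open>N\<close>'s is an ADI word, as one sees by running the machine backwards.

  The map \<open>Phi\<close> can be undone on these words.  The ranks of the \<open>D\<close>'s determine the lengths \<open>k\<close>, and an
  \<open>N\<close> of the contracted word comes from a group if and only if the first stack is empty at that point.
  The word is legal if and only if the path stays weakly below the diagonal, since the excess of the
  path is the size of the first stack plus the number of further groups for which enough values
  have already reached the second stack.
\<close>

section \<open>Sortable configurations\<close>

text \<open>The output is not recorded: a value may leave only when it is smaller than everything
  that remains, which forces increasing output. The order of a stack is tested only on pushing, so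
  the order of the given \<open>s\<close> and \<open>t\<close> is assumed separately where it
  matters.\<close>

inductive sorts :: "letter list \<Rightarrow> nat list \<Rightarrow> nat list \<Rightarrow> nat list \<Rightarrow> bool" where
  sorts_Nil: "sorts [] [] [] []"
| sorts_E: "sorts w inp (x # s) t \<Longrightarrow> \<forall>y\<in>set s. y < x \<Longrightarrow> sorts (E # w) (x # inp) s t"
| sorts_N: "sorts w inp s (x # t) \<Longrightarrow> \<forall>y\<in>set t. x < y \<Longrightarrow> sorts (N # w) inp (x # s) t"
| sorts_C: "sorts w inp s t \<Longrightarrow> \<forall>y\<in>set inp \<union> set s \<union> set t. x < y \<Longrightarrow> sorts (C # w) inp s (x # t)"

lemma sorts_replicate_C:
  assumes "sorts w inp s t" "\<forall>y\<in>set inp \<union> set s \<union> set t. a + k \<le> y"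
  shows "sorts (replicate k C @ w) inp s ([a..<a + k] @ t)"
  using assms
proof (induction k arbitrary: a)
  case (Suc k)
  have "sorts (replicate k C @ w) inp s ([Suc a..<Suc a + k] @ t)"
    using Suc.IH[of "Suc a"] Suc.prems by auto
  moreover have "[a..<a + Suc k] = a # [Suc a..<Suc a + k]"
    by (simp add: upt_conv_Cons del: upt_Suc)
  moreover have "\<forall>y\<in>set inp \<union> set s \<union> set ([Suc a..<Suc a + k] @ t). a < y"
  proof
    fix y assume "y \<in> set inp \<union> set s \<union> set ([Suc a..<Suc a + k] @ t)"
    then show "a < y"
      using bspec[OF Suc.prems(2), of y] by (cases "y \<in> {Suc a..<Suc a + k}") auto
  qed
  ultimately show ?case by (simp add: sorts_C del: upt_Suc)
qed simp

section \<open>Correspondence with DI words\<close>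

lemma exec_word_output:
  "exec_word w (inp, s, t, out) = Some (inp', s', t', out') \<Longrightarrow> \<exists>zs. out' = out @ zs"
proof (induction w arbitrary: inp s t out)
  case (Cons a w)
  obtain c where c: "exec a (inp, s, t, out) = Some c"
    "exec_word w c = Some (inp', s', t', out')"
    using Cons.prems by (auto simp: bind_eq_Some_conv)
  obtain i1 s1 t1 o1 where [simp]: "c = (i1, s1, t1, o1)" by (cases c)
  have "\<exists>zs. o1 = out @ zs" using c(1) by (cases "(a, inp, s, t, out)" rule: exec.cases) auto
  then show ?case using Cons.IH[of i1 s1 t1 o1] c(2) by auto
qed simp

text \<open>Starting from an arbitrary configuration makes induction on the word possible;
  \<open>n\<close> is a parameter because the input shrinks along the way.\<close>

definition di_run :: "nat \<Rightarrow> letter list \<Rightarrow> config \<Rightarrow> bool" where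
  "di_run n w c \<longleftrightarrow>
     (\<forall>k\<le>length w. \<exists>c'. exec_word (take k w) c = Some c' \<and> di_config c') \<and>
     (\<exists>inp s t. exec_word w c = Some (inp, s, t, [1..<Suc n]))"

lemma di_word_iff_di_run: "di_word p w \<longleftrightarrow> di_run (length p) w (initial p)"
  by (simp add: di_word_def di_run_def)

lemma di_run_Nil: "di_run n [] (inp, s, t, out) \<longleftrightarrow> di_config (inp, s, t, out) \<and> out = [1..<Suc n]"
  by (auto simp: di_run_def)

lemma all_le_Suc_iff: "(\<forall>k\<le>Suc m. P k) \<longleftrightarrow> P 0 \<and> (\<forall>k\<le>m. P (Suc k))"
  by (metis Suc_le_mono bot_nat_0.extremum not0_implies_Suc)

lemma di_run_Cons:
  "di_run n (a # w) c \<longleftrightarrow> di_config c \<and> (\<exists>c'. exec a c = Some c' \<and> di_run n w c')"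
  unfolding di_run_def length_Cons all_le_Suc_iff
  by (cases "exec a c") (simp_all del: upt_Suc)

lemma di_run_output: "di_run n w (inp, s, t, out) \<Longrightarrow> \<exists>zs. [1..<Suc n] = out @ zs"
  using exec_word_output by (fastforce simp: di_run_def simp del: upt_Suc)

text \<open>Only \<open>C\<close> needs an argument: the final output is increasing and extends the
  present one, and by the multiset hypothesis the values that follow the popped one in it are
  exactly those left in the input and the stacks.\<close>

lemma sorts_of_di_run:
  assumes "di_run n w (inp, s, t, out)" "mset (out @ inp @ s @ t) = mset [1..<Suc n]"
  shows "sorts w inp s t"
  using assms
proof (induction w arbitrary: inp s t out)
  case Nil
  then have "out = [1..<Suc n]" by (simp add: di_run_Nil)
  with Nil.prems(2) show ?case by (simp add: sorts_Nil del: upt_Suc)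
next
  case (Cons a w)
  then obtain c1 where c1: "exec a (inp, s, t, out) = Some c1" "di_run n w c1"
    by (auto simp: di_run_Cons)
  have di: "di_config c1" using c1(2) by (auto simp: di_run_def)
  show ?case
  proof (cases a)
    case [simp]: E
    then obtain x i where [simp]: "inp = x # i" "c1 = (i, x # s, t, out)"
      using c1(1) by (cases inp) auto
    have "sorts w i (x # s) t"
      using Cons.IH[of i "x # s" t out] c1(2) Cons.prems(2) by (simp del: upt_Suc)
    then show ?thesis using di by (auto intro: sorts_E)
  next
    case [simp]: N
    then obtain x r where [simp]: "s = x # r" "c1 = (inp, r, x # t, out)"
      using c1(1) by (cases s) auto
    have "sorts w inp r (x # t)"
      using Cons.IH[of inp r "x # t" out] c1(2) Cons.prems(2) by (simp del: upt_Suc)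
    then show ?thesis using di by (auto intro: sorts_N)
  next
    case [simp]: C
    then obtain x r where [simp]: "t = x # r" "c1 = (inp, s, r, out @ [x])"
      using c1(1) by (cases t) auto
    have *: "sorts w inp s r"
      using Cons.IH[of inp s r "out @ [x]"] c1(2) Cons.prems(2) by (simp del: upt_Suc)
    obtain zs where zs: "[1..<Suc n] = out @ x # zs"
      using di_run_output[of n w inp s r "out @ [x]"] c1(2) by auto
    have "sorted_wrt (<) (out @ x # zs)" unfolding zs[symmetric] by (rule sorted_wrt_upt)
    moreover have "set zs = set (inp @ s @ r)"
      using Cons.prems(2) unfolding zs by (intro mset_eq_setD) simp
    ultimately have "\<forall>y\<in>set inp \<union> set s \<union> set r. x < y" by (auto simp: sorted_wrt_append)
    with * show ?thesis by (auto intro: sorts_C)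
  next
    case D with c1(1) show ?thesis by simp
  qed
qed

text \<open>In the case of \<open>C\<close> the remaining values form the interval from
  \<open>Suc (length out)\<close> to \<open>n\<close>, so a value below all others must be its lower
  end, and the output stays an initial segment.\<close>

lemma di_run_of_sorts:
  assumes "sorts w inp s t" "distinct (inp @ s @ t)" "set (inp @ s @ t) = {Suc (length out)..n}"
    "out = [1..<Suc (length out)]" "length out \<le> n" "sorted_wrt (>) s" "sorted_wrt (<) t"
  shows "di_run n w (inp, s, t, out)"
  using assms
proof (induction arbitrary: out rule: sorts.induct)
  case sorts_Nil
  from sorts_Nil.prems(2,4) have "length out = n" by auto
  with sorts_Nil.prems(3) show ?case by (simp add: di_run_Nil del: upt_Suc)
next
  case (sorts_E w inp x s t)
  have "di_run n w (inp, x # s, t, out)"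
    using sorts_E.hyps sorts_E.prems(1,2,5,6)
    by (intro sorts_E.IH[OF _ _ sorts_E.prems(3,4)]) auto
  with sorts_E.prems(5,6) show ?case by (simp add: di_run_Cons)
next
  case (sorts_N w inp s x t)
  have "di_run n w (inp, s, x # t, out)"
    using sorts_N.hyps sorts_N.prems(1,2,5,6)
    by (intro sorts_N.IH[OF _ _ sorts_N.prems(3,4)]) auto
  with sorts_N.prems(5,6) show ?case by (simp add: di_run_Cons)
next
  case (sorts_C w inp s t x)
  have eq: "insert x (set inp \<union> set s \<union> set t) = {Suc (length out)..n}"
    using sorts_C.prems(2) by auto
  then have *: "Suc (length out) \<le> x" "x \<le> n" by (metis atLeastAtMost_iff insertI1)+
  then have "Suc (length out) \<in> insert x (set inp \<union> set s \<union> set t)" unfolding eq by simp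
  with * have x: "x = Suc (length out)"
    using sorts_C.hyps(2) by (metis Un_iff insertE leD)
  have "di_run n w (inp, s, t, out @ [x])"
  proof (rule sorts_C.IH)
    show "out @ [x] = [1..<Suc (length (out @ [x]))]" using sorts_C.prems(3) by (simp add: x)
    have "set (inp @ s @ t) = {Suc (length out)..n} - {x}"
      using sorts_C.hyps(2) by (fastforce simp: eq[symmetric])
    also have "\<dots> = {Suc (length (out @ [x]))..n}" using x by auto
    finally show "set (inp @ s @ t) = {Suc (length (out @ [x]))..n}" .
  qed (use sorts_C.prems(1,5,6) * x in auto)
  with sorts_C.prems(5,6) show ?case by (simp add: di_run_Cons)
qed

lemma di_sortable_iff_sorts:
  assumes "p \<in> permutations_of_set {1..n}"
  shows "di_sortable p \<longleftrightarrow> (\<exists>w. sorts w p [] [])"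
proof -
  have p: "set p = {1..n}" "distinct p"
    using assms by (auto simp: permutations_of_set_def)
  have l: "length p = n" using distinct_card[OF p(2)] p(1) by simp
  have "mset p = mset [1..<Suc n]"
    using set_eq_iff_mset_eq_distinct[OF p(2) distinct_upt[of 1 "Suc n"]] p(1)
    by (simp add: atLeastLessThanSuc_atLeastAtMost del: upt_Suc)
  then have "di_run n w (p, [], [], []) \<longleftrightarrow> sorts w p [] []" for w
    using sorts_of_di_run[of n w p "[]" "[]" "[]"] di_run_of_sorts[of w p "[]" "[]" "[]" n] p
    by (auto simp del: upt_Suc)
  then show ?thesis by (simp add: di_sortable_def di_word_iff_di_run initial_def l)
qed

text \<open>The first \<open>C\<close> can only release the minimum \<open>x\<close>, so it suffices
  to omit that \<open>C\<close> and the transfer of \<open>x\<close>, if there is one. Hence the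
  algorithm may output \<open>x\<close> early without losing sortability.\<close>

lemma delete_min:
  assumes "sorts w inp s t" "x \<in> set s \<union> set t" "x \<notin> set inp"
    "\<forall>y\<in>set inp \<union> set s \<union> set t. x \<le> y"
  shows "\<exists>w'. sorts w' inp (filter ((\<noteq>) x) s) (filter ((\<noteq>) x) t)"
  using assms
proof (induction rule: sorts.induct)
  case (sorts_E w inp z s t)
  then obtain w' where "sorts w' inp (filter ((\<noteq>) x) (z # s)) (filter ((\<noteq>) x) t)" by auto
  then have "sorts (E # w') (z # inp) (filter ((\<noteq>) x) s) (filter ((\<noteq>) x) t)"
    using sorts_E.hyps(2) sorts_E.prems(2) by (intro sorts.sorts_E) auto
  then show ?case by blast
next
  case (sorts_N w inp s z t)
  then obtain w' where w': "sorts w' inp (filter ((\<noteq>) x) s) (filter ((\<noteq>) x) (z # t))" by auto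
  show ?case
  proof (cases "z = x")
    case True then show ?thesis using w' by auto
  next
    case False
    then have "sorts (N # w') inp (z # filter ((\<noteq>) x) s) (filter ((\<noteq>) x) t)"
      using w' sorts_N.hyps(2) by (intro sorts.sorts_N) auto
    with False show ?thesis by (intro exI[of _ "N # w'"]) simp
  qed
next
  case (sorts_C w inp s t z)
  have "x \<le> z" using sorts_C.prems(3) by simp
  moreover have "x = z \<or> z < x" using sorts_C.hyps(2) sorts_C.prems(1) by auto
  ultimately have "z = x" by linarith
  moreover have "filter ((\<noteq>) z) s = s" "filter ((\<noteq>) z) t = t"
    using sorts_C.hyps(2) by (auto simp: filter_id_conv)
  ultimately show ?case using sorts_C.hyps(1) by auto
qed simp

text \<open>The minimum \<open>m\<close> has to leave first, but it is blocked by \<open>x\<close>, which is blocked by \<open>a\<close>.\<close>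

lemma not_sorts_blocked:
  assumes "sorts w inp s t" "m \<in> set inp" "x \<in> set s" "a \<in> set t" "m < a" "a < x"
  shows False
  using assms
proof (induction rule: sorts.induct)
  case (sorts_E w inp z s t)
  then show ?case using order.strict_trans[of m a x] less_asym by auto
next
  case (sorts_N w inp s z t)
  then show ?case using less_asym by auto
next
  case (sorts_C w inp s t z)
  then have "z < m" by simp
  then show ?case using sorts_C less_asym[of z m] by auto
qed simp

text \<open>Until \<open>x\<close> is read, \<open>m\<close> stays in the input and so
  \<open>a\<close> cannot leave; once \<open>x\<close> is in the first stack,
  \<open>not_sorts_blocked\<close> applies. This rules out wrong first moves of a sorting
  word.\<close>

lemma not_sorts_blocked_input:
  assumes "sorts w inp s t" "inp = x # inp'" "m \<in> set inp'" "a \<in> set t" "m < a" "a < x"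
  shows False
  using assms
proof (induction rule: sorts.induct)
  case (sorts_E w inp z s t)
  then show ?case using not_sorts_blocked[of w inp "x # s" t m x a] by auto
next
  case (sorts_C w inp s t z)
  then have "z < m" by simp
  then show ?case using sorts_C less_asym[of z m] by auto
qed simp_all

section \<open>ADI words as token sequences\<close>

lemma sorts_step:
  assumes "sorts w inp s t"
  obtains (stop) "inp = []" "s = []" "t = []"
  | (E) w' x inp' where "inp = x # inp'" "sorts w' inp' (x # s) t" "\<forall>y\<in>set s. y < x"
  | (N) w' x s' where "s = x # s'" "sorts w' inp s' (x # t)" "\<forall>y\<in>set t. x < y"
  | (C) w' x t' where "t = x # t'" "sorts w' inp s t'" "\<forall>y\<in>set inp \<union> set s \<union> set t'. x < y"
  using assms by (cases rule: sorts.cases) blast+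

section \<open>Single stages of the algorithm\<close>

lemma hd_sort:
  assumes "m \<in> set xs" "\<forall>y\<in>set xs. m \<le> y"
  shows "hd (sort xs) = m"
proof (cases "sort xs")
  case Nil
  with assms(1) show ?thesis by (metis empty_iff list.set(1) set_sort)
next
  case (Cons z zs)
  have "z \<in> set xs" by (metis Cons list.set_intros(1) set_sort)
  moreover have "sorted (z # zs)" by (metis Cons sorted_sort)
  moreover have "m \<in> set (z # zs)" by (metis Cons assms(1) set_sort)
  ultimately show ?thesis using assms(2) Cons by force
qed

lemma take_sort_min:
  assumes "m \<in> set xs" "\<forall>y\<in>set xs. m \<le> y" "k > 0"
  shows "m \<in> set (take k (sort xs))"
proof -
  have "sort xs \<noteq> []" using assms(1) by (metis empty_iff list.set(1) set_sort)
  then show ?thesis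
    using hd_sort[OF assms(1,2)] assms(3) by (cases "sort xs"; cases k) auto
qed

lemma adi_from_Nil: "adi_from ([], [], [], out) = []"
  by (simp add: adi_from.simps)

lemma adi_from_step:
  assumes "inp @ s @ t \<noteq> []" "adi_stage (inp, s, t, out) = [a]" "exec a (inp, s, t, out) = Some c"
  shows "adi_from (inp, s, t, out) = a # adi_from c"
proof -
  have "pending (inp, s, t, out) \<noteq> []" using assms(1) by (metis pending.simps set_empty set_sort)
  then show ?thesis
    using assms(2,3) by (subst adi_from.simps) (simp del: adi_stage.simps pending.simps)
qed

lemma adi_from_C:
  assumes "\<forall>y\<in>set inp \<union> set s \<union> set t. x < y"
  shows "adi_from (inp, s, x # t, out) = C # adi_from (inp, s, t, out @ [x])"
proof -
  have "hd (sort (inp @ s @ x # t)) = x" by (rule hd_sort) (use assms in \<open>auto intro: less_imp_le\<close>)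
  then show ?thesis by (intro adi_from_step) auto
qed

lemma adi_from_transfer_min:
  assumes "\<forall>y\<in>set inp \<union> set t. x < y"
  shows "adi_from (inp, [x], t, out) = N # adi_from (inp, [], x # t, out)"
proof -
  have h: "hd (sort (inp @ x # t)) = x" by (rule hd_sort) (use assms in \<open>auto intro: less_imp_le\<close>)
  moreover have "sort (inp @ x # t) \<noteq> []" by (metis append_is_Nil_conv list.distinct(1) set_empty set_sort)
  ultimately have "set (take (Suc 0) (sort (inp @ x # t))) = {x}"
    by (cases "sort (inp @ x # t)") auto
  moreover have "t \<noteq> [] \<Longrightarrow> hd t \<noteq> x" using assms by auto
  ultimately show ?thesis using h by (intro adi_from_step) auto
qed

text \<open>Output and transfer of the whole first stack both require the smallest pending value to
  lie in a stack, which is excluded here. Only the last two cases of \<open>adi_stage\<close>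
  remain.\<close>

lemma adi_stage_pending_min_in_input:
  assumes "m \<in> set inp" "\<forall>y\<in>set s \<union> set t. m < y"
  shows "adi_stage (inp, s, t, out) =
    (if (t = [] \<or> hd inp < hd t) \<and> (s = [] \<or> hd inp > hd s) then [E] else [N])"
proof -
  \<comment> \<open>\<open>m\<close> lies below both stacks but may not be the least input entry,
    whereas the facts on \<open>sort\<close> concern the true minimum.\<close>
  define m' where "m' = Min (set inp)"
  have m': "m' \<in> set inp" "\<forall>y\<in>set inp. m' \<le> y" "m' \<le> m"
    using assms(1) by (auto simp: m'_def intro!: Min_in)
  have lt: "\<forall>y\<in>set s \<union> set t. m' < y" using assms(2) m'(3) by (meson order_le_less_trans)
  have min: "m' \<in> set (inp @ s @ t)" "\<forall>y\<in>set (inp @ s @ t). m' \<le> y"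
    using m' lt by (auto intro: less_imp_le)
  have no_output: "\<not> (t \<noteq> [] \<and> hd t = hd (sort (inp @ s @ t)))"
    unfolding hd_sort[OF min] using lt by (cases t) auto
  have no_transfer: "\<not> (s \<noteq> [] \<and> set s = set (take (length s) (sort (inp @ s @ t))))"
  proof
    assume *: "s \<noteq> [] \<and> set s = set (take (length s) (sort (inp @ s @ t)))"
    then have "m' \<in> set s" using take_sort_min[OF min, of "length s"] by simp
    with lt show False by auto
  qed
  have "inp \<noteq> []" using assms(1) by auto
  then show ?thesis
    by (simp only: adi_stage.simps pending.simps no_output no_transfer if_False simp_thms)
qed

lemma adi_from_E:
  assumes "m \<in> set (x # inp)" "\<forall>y\<in>set s \<union> set t. m < y"
    "t = [] \<or> x < hd t" "s = [] \<or> hd s < x"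
  shows "adi_from (x # inp, s, t, out) = E # adi_from (inp, x # s, t, out)"
  by (rule adi_from_step)
    (use assms in \<open>auto simp: adi_stage_pending_min_in_input[OF assms(1,2)] simp del: adi_stage.simps\<close>)

lemma adi_from_N:
  assumes "m \<in> set inp" "\<forall>y\<in>set (a # s) \<union> set t. m < y"
    "\<not> ((t = [] \<or> hd inp < hd t) \<and> a < hd inp)"
  shows "adi_from (inp, a # s, t, out) = N # adi_from (inp, s, a # t, out)"
  by (rule adi_from_step)
    (use assms in \<open>auto simp: adi_stage_pending_min_in_input[OF assms(1,2)] simp del: adi_stage.simps\<close>)

text \<open>
  An ADI word is a sequence of tokens: \<open>Block k\<close> stands for \<open>E N C\<^sup>k\<close>, which only occurs when the
  first stack is empty, and \<open>Enter\<close>, \<open>Transfer\<close> for the remaining letters \<open>E\<close>, \<open>N\<close>.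
\<close>

datatype token = Enter | Transfer | Block nat

fun spell :: "token list \<Rightarrow> letter list" where
  "spell [] = []"
| "spell (Enter # ts) = E # spell ts"
| "spell (Transfer # ts) = N # spell ts"
| "spell (Block k # ts) = E # N # replicate k C @ spell ts"

text \<open>Here \<open>h\<close> and \<open>d\<close> are the sizes of the first and the second stack.\<close>

fun admissible :: "nat \<Rightarrow> nat \<Rightarrow> token list \<Rightarrow> bool" where
  "admissible h d [] \<longleftrightarrow> h = 0 \<and> d = 0"
| "admissible h d (Enter # ts) \<longleftrightarrow> admissible (Suc h) d ts"
| "admissible h d (Transfer # ts) \<longleftrightarrow> h > 0 \<and> admissible (h - 1) (Suc d) ts"
| "admissible h d (Block k # ts) \<longleftrightarrow> h = 0 \<and> 0 < k \<and> k \<le> Suc d \<and> admissible 0 (Suc d - k) ts"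

definition inputs :: "token list \<Rightarrow> nat" where
  "inputs ts = length (filter ((\<noteq>) Transfer) ts)"

lemma inputs_simps [simp]:
  "inputs [] = 0" "inputs (Enter # ts) = Suc (inputs ts)"
  "inputs (Transfer # ts) = inputs ts" "inputs (Block k # ts) = Suc (inputs ts)"
  by (simp_all add: inputs_def)

text \<open>The last hypothesis is an invariant: while the first stack is occupied, the smallest
  pending value is in the input. The \<open>j\<close> leading \<open>C\<close>'s complete a
  \<open>Block\<close> that began before this configuration. Following the algorithm, the sorting
  word \<open>w\<close> is replaced at each stage to show that sortability persists.\<close>

lemma adi_from_tokens:
  assumes "sorts w inp s t" "distinct (inp @ s @ t)" "sorted_wrt (>) s" "sorted_wrt (<) t"
    "s = [] \<or> (\<exists>m\<in>set inp. \<forall>y\<in>set s \<union> set t. m < y)"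
  shows "\<exists>j ts. adi_from (inp, s, t, out) = replicate j C @ spell ts \<and> j \<le> length t \<and>
    admissible (length s) (length t - j) ts \<and> inputs ts = length inp \<and>
    ((\<exists>m\<in>set inp. \<forall>y\<in>set s \<union> set t. m < y) \<longrightarrow> j = 0)"
  using assms
proof (induction "potential (inp, s, t, out)" arbitrary: w inp s t out rule: less_induct)
  case less
  note IH = less.hyps and run = less.prems(1) and dist = less.prems(2)
    and s_sorted = less.prems(3) and t_sorted = less.prems(4)
  \<comment> \<open>By the invariant the smallest pending value, if any, is in the input or on top
    of the second stack; in the latter case the first stack is empty.\<close>
  consider (empty) "inp = []" "s = []" "t = []"
    | (pop) x t' where "s = []" "t = x # t'" "\<forall>y\<in>set inp. x < y"
    | (pending) m where "m \<in> set inp" "\<forall>y\<in>set s \<union> set t. m < y" "\<forall>y\<in>set inp. m \<le> y"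
  proof (cases "\<exists>m\<in>set inp. \<forall>y\<in>set s \<union> set t. m < y")
    case True
    then obtain m where "m \<in> set inp" "\<forall>y\<in>set s \<union> set t. m < y" by blast
    then have "\<forall>y\<in>set s \<union> set t. Min (set inp) < y"
      by (meson List.finite_set Min_le order_le_less_trans)
    moreover have "Min (set inp) \<in> set inp" "\<forall>y\<in>set inp. Min (set inp) \<le> y"
      using \<open>m \<in> set inp\<close> by (auto intro!: Min_in)
    ultimately show ?thesis using pending by blast
  next
    case False
    then have s: "s = []" using less.prems(5) by blast
    show ?thesis
    proof (cases t)
      case Nil
      with False s have "inp = []" by (cases inp) auto
      with Nil s show ?thesis using empty by blast
    next
      case (Cons x t')
      have "x < y" if "y \<in> set inp" for y
      proof (rule ccontr)
        assume "\<not> x < y"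
        then have "y < x" using dist that Cons by (cases "x = y") auto
        then have "\<forall>z\<in>set s \<union> set t. y < z" using t_sorted Cons s by auto
        with that False show False by blast
      qed
      with s Cons show ?thesis using pop by blast
    qed
  qed
  then show ?case
  proof cases
    case empty
    then show ?thesis by (auto simp: adi_from_Nil intro!: exI[of _ 0] exI[of _ "[]"])
  next
    case pop
    have x: "\<forall>y\<in>set inp \<union> set s \<union> set t'. x < y" using pop t_sorted by auto
    have "\<exists>w'. sorts w' inp (filter ((\<noteq>) x) s) (filter ((\<noteq>) x) t)"
      by (rule delete_min[OF run]) (use pop x in \<open>auto intro: less_imp_le\<close>)
    moreover have "filter ((\<noteq>) x) t' = t'" using x by (auto simp: filter_id_conv)
    ultimately obtain w' where "sorts w' inp s t'" using pop by auto
    then obtain j ts where "adi_from (inp, s, t', out @ [x]) = replicate j C @ spell ts"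
      "j \<le> length t'" "admissible (length s) (length t' - j) ts" "inputs ts = length inp"
      using IH[of inp s t' "out @ [x]" w'] dist s_sorted t_sorted pop by auto
    then show ?thesis using adi_from_C[OF x, of out] pop(1,2)
      by (intro exI[of _ "Suc j"] exI[of _ ts]) (use pop in force)
  next
    case pending
    then obtain x inp' where inp: "inp = x # inp'" by (cases inp) auto
    show ?thesis
    proof (cases "x = m \<and> s = []")
      case True
      then have x: "\<forall>y\<in>set inp' \<union> set [] \<union> set t. x < y"
        using pending dist inp by (force simp: order_less_le)
      have "t = [] \<or> x < hd t" using x by (cases t) auto
      then have "adi_from (inp, s, t, out) = E # adi_from (inp', [x], t, out)"
        using adi_from_E[of m x inp' s t out] pending inp True by auto
      also have "adi_from (inp', [x], t, out) = N # C # adi_from (inp', [], t, out @ [x])"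
        using adi_from_transfer_min[of inp' t x out] adi_from_C[OF x] x by simp
      finally have adi: "adi_from (inp, s, t, out) = E # N # C # adi_from (inp', [], t, out @ [x])" .
      \<comment> \<open>A sorting word has to begin with \<open>E\<close>: the first stack is empty
        and the top of \<open>t\<close> exceeds \<open>x\<close>, which is still in the
        input.\<close>
      obtain w1 where "sorts w1 inp' [x] t"
        using run
      proof (cases rule: sorts_step)
        case (C w' a t')
        with x inp have "a < x" "x < a" by auto
        then show thesis by simp
      qed (use True that inp in auto)
      then have "\<exists>w'. sorts w' inp' (filter ((\<noteq>) x) [x]) (filter ((\<noteq>) x) t)"
        by (rule delete_min) (use x in \<open>auto intro: less_imp_le\<close>)
      moreover have "filter ((\<noteq>) x) t = t" using x by (auto simp: filter_id_conv)
      ultimately obtain w' where "sorts w' inp' [] t" by auto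
      then obtain j ts where "adi_from (inp', [], t, out @ [x]) = replicate j C @ spell ts"
        "j \<le> length t" "admissible 0 (length t - j) ts" "inputs ts = length inp'"
        using IH[of inp' "[]" t "out @ [x]" w'] dist t_sorted inp True by auto
      \<comment> \<open>The \<open>j\<close> further \<open>C\<close>'s join the one after
        \<open>E N\<close>, giving a block of length \<open>Suc j\<close>.\<close>
      then show ?thesis using adi True inp
        by (intro exI[of _ 0] exI[of _ "Block (Suc j) # ts"]) auto
    next
      case False
      have m: "m \<in> set inp'" if "x \<noteq> m" using pending(1) inp that by auto
      show ?thesis
      proof (cases "(t = [] \<or> x < hd t) \<and> (s = [] \<or> hd s < x)")
        case True
        have "x \<noteq> m" using True False pending(2) by (cases s) auto
        obtain w1 where w1: "sorts w1 inp' (x # s) t"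
          using run
        proof (cases rule: sorts_step)
          \<comment> \<open>The transfer would put \<open>a\<close> into the second stack with
            \<open>m < a < x\<close>, while \<open>x\<close> is read before
            \<open>m\<close>.\<close>
          case (N w' a s')
          then have "a < x" "m < a" using True pending(2) by auto
          then have False
            using not_sorts_blocked_input[OF N(2) inp m[OF \<open>x \<noteq> m\<close>], of a] by simp
          then show thesis ..
        next
          case (C w' a t')
          with pending inp have "a < m" "m < a" by auto
          then show thesis by simp
        qed (use inp that in auto)
        have "adi_from (inp, s, t, out) = E # adi_from (inp', x # s, t, out)"
          using adi_from_E[of m x inp' s t out] pending inp True by auto
        moreover have "\<exists>j ts. adi_from (inp', x # s, t, out) = replicate j C @ spell ts \<and> j \<le> length t \<and>
            admissible (length (x # s)) (length t - j) ts \<and> inputs ts = length inp' \<and>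
            ((\<exists>m\<in>set inp'. \<forall>y\<in>set (x # s) \<union> set t. m < y) \<longrightarrow> j = 0)"
        proof (rule IH[OF _ w1])
          show "sorted_wrt (>) (x # s)" using s_sorted True by (cases s) auto
          have "m < x" using \<open>x \<noteq> m\<close> pending(3) inp by auto
          with m[OF \<open>x \<noteq> m\<close>] pending(2)
          show "x # s = [] \<or> (\<exists>m\<in>set inp'. \<forall>y\<in>set (x # s) \<union> set t. m < y)" by auto
        qed (use inp dist t_sorted in auto)
        moreover have "\<exists>m\<in>set inp'. \<forall>y\<in>set (x # s) \<union> set t. m < y"
          using m[OF \<open>x \<noteq> m\<close>] pending(2,3) inp \<open>x \<noteq> m\<close> by (intro bexI[of _ m]) auto
        ultimately obtain ts where "adi_from (inp, s, t, out) = E # spell ts"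
          "admissible (Suc (length s)) (length t) ts" "inputs ts = length inp'" by auto
        then show ?thesis using inp by (intro exI[of _ 0] exI[of _ "Enter # ts"]) auto
      next
        case no_E: False
        obtain a s' w1 where a: "s = a # s'" "sorts w1 inp s' (a # t)" "\<forall>y\<in>set t. a < y"
          using run
        proof (cases rule: sorts_step)
          \<comment> \<open>If a sorting word began with \<open>E\<close>, the comparison that fails
            for the algorithm would be the one with \<open>hd t\<close>. Then
            \<open>m < hd t < x\<close>, and \<open>x\<close> would be blocked.\<close>
          case (E w' x' i')
          then have "s = [] \<or> hd s < x" using inp by (cases s) auto
          then have "t \<noteq> []" "hd t \<noteq> x \<Longrightarrow> hd t < x" using no_E by auto
          moreover have "hd t \<noteq> x" using dist inp \<open>t \<noteq> []\<close> by (cases t) auto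
          ultimately have t: "hd t \<in> set t" "hd t < x" by auto
          then have "m < hd t" using pending(2) by auto
          then have "m \<in> set inp'" using m t by auto
          then have False
            using not_sorts_blocked_input[OF run inp _ t(1) \<open>m < hd t\<close> t(2)] by blast
          then show thesis ..
        next
          case (C w' a t')
          with pending inp have "a < m" "m < a" by auto
          then show thesis by simp
        qed (use that inp in auto)
        have "adi_from (inp, s, t, out) = N # adi_from (inp, s', a # t, out)"
          unfolding a(1) by (rule adi_from_N[OF pending(1)]) (use pending(2) a(1) no_E inp in auto)
        moreover have "\<exists>j ts. adi_from (inp, s', a # t, out) = replicate j C @ spell ts \<and>
            j \<le> length (a # t) \<and> admissible (length s') (length (a # t) - j) ts \<and>
            inputs ts = length inp \<and> ((\<exists>m\<in>set inp. \<forall>y\<in>set s' \<union> set (a # t). m < y) \<longrightarrow> j = 0)"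
          by (rule IH[OF _ a(2)]) (use a dist s_sorted t_sorted pending in auto)
        moreover have "\<exists>m\<in>set inp. \<forall>y\<in>set s' \<union> set (a # t). m < y"
          using pending a(1) by (intro bexI[of _ m]) auto
        ultimately obtain ts where "adi_from (inp, s, t, out) = N # spell ts"
          "admissible (length s') (Suc (length t)) ts" "inputs ts = length inp" by auto
        then show ?thesis using a(1) by (intro exI[of _ 0] exI[of _ "Transfer # ts"]) auto
      qed
    qed
  qed
qed

section \<open>Configurations with a prescribed token sequence\<close>

lemma adi_from_replicate_C:
  assumes "\<forall>y\<in>set inp \<union> set s \<union> set t. a + k \<le> y"
  shows "\<exists>out'. adi_from (inp, s, [a..<a + k] @ t, out) = replicate k C @ adi_from (inp, s, t, out')"
  using assms
proof (induction k arbitrary: a out)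
  case (Suc k)
  have *: "a < y" if "y \<in> set inp \<union> set s \<union> set ([Suc a..<Suc a + k] @ t)" for y
    using that bspec[OF Suc.prems, of y] by (cases "y \<in> {Suc a..<Suc a + k}") auto
  have "[a..<a + Suc k] = a # [Suc a..<Suc a + k]"
    by (simp add: upt_conv_Cons del: upt_Suc)
  then show ?case
    using adi_from_C[of inp s "[Suc a..<Suc a + k] @ t" a out] * Suc.IH[of "Suc a" "out @ [a]"] Suc.prems
    by (auto simp del: upt_Suc)
qed auto

text \<open>
  The machine is run backwards.  Until the next \<open>Block\<close> everything goes to the second stack on top
  of what is there, which is why those entries have to be smaller.
\<close>

lemma config_of_tokens:
  assumes "admissible h d ts" "b + h + d + inputs ts = n"
  shows "\<exists>inp s t. length s = h \<and> length t = d \<and>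
    distinct (inp @ s @ t) \<and> set (inp @ s @ t) = {Suc b..n} \<and>
    sorted_wrt (>) s \<and> sorted_wrt (<) t \<and> (\<forall>x\<in>set s. \<forall>y\<in>set t. x < y) \<and>
    (inp \<noteq> [] \<longrightarrow> (\<forall>y\<in>set t. hd inp < y)) \<and> (ts \<noteq> [] \<longrightarrow> Suc b \<in> set inp) \<and>
    sorts (spell ts) inp s t \<and> (\<forall>out. adi_from (inp, s, t, out) = spell ts)"
  using assms
proof (induction ts arbitrary: h d b rule: spell.induct)
  case 1
  then show ?case by (auto simp: adi_from_Nil sorts_Nil)
next
  case (2 ts)
  have "admissible (Suc h) d ts" "b + Suc h + d + inputs ts = n" using 2(2,3) by auto
  from "2.IH"[OF this] obtain inp s t where len: "length s = Suc h" "length t = d"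
    and dist: "distinct (inp @ s @ t)" and range: "set (inp @ s @ t) = {Suc b..n}"
    and sorted: "sorted_wrt (>) s" "sorted_wrt (<) t" "\<forall>x\<in>set s. \<forall>y\<in>set t. x < y"
    and min: "ts \<noteq> [] \<longrightarrow> Suc b \<in> set inp"
    and run: "sorts (spell ts) inp s t" "\<forall>out. adi_from (inp, s, t, out) = spell ts"
    by blast
  obtain x s' where s: "s = x # s'" using len by (cases s) auto
  \<comment> \<open>\<open>ts\<close> is not empty, since the empty sequence is admissible only for
    empty stacks.\<close>
  have m: "Suc b \<in> set inp" using min 2 by (cases ts) auto
  have "\<forall>y\<in>set s' \<union> set t. Suc b < y"
  proof
    fix y assume y: "y \<in> set s' \<union> set t"
    then have "y \<in> {Suc b..n}" unfolding range[symmetric] s by auto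
    moreover have "y \<noteq> Suc b" using dist m y s by auto
    ultimately show "Suc b < y" by simp
  qed
  then have "adi_from (x # inp, s', t, out) = E # adi_from (inp, x # s', t, out)" for out
    by (rule adi_from_E[of "Suc b", rotated]) (use m sorted s in \<open>cases t; cases s'; auto\<close>)+
  then have "\<forall>out. adi_from (x # inp, s', t, out) = spell (Enter # ts)"
    using run(2) s by simp
  moreover have "sorts (spell (Enter # ts)) (x # inp) s' t"
    using run(1) sorted(1) s by (auto intro: sorts_E)
  moreover have "length s' = h" using len s by simp
  moreover have "distinct ((x # inp) @ s' @ t)" using dist s by auto
  moreover have "set ((x # inp) @ s' @ t) = {Suc b..n}" unfolding range[symmetric] s by auto
  moreover have "sorted_wrt (>) s'" "\<forall>y\<in>set s'. \<forall>z\<in>set t. y < z" "\<forall>y\<in>set t. hd (x # inp) < y"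
    using sorted s by auto
  moreover have "Suc b \<in> set (x # inp)" using m by simp
  ultimately show ?case using len(2) sorted(2) by blast
next
  case (3 ts)
  have "admissible (h - 1) (Suc d) ts" "b + (h - 1) + Suc d + inputs ts = n" using 3(2,3) by auto
  from "3.IH"[OF this] obtain inp s t where len: "length s = h - 1" "length t = Suc d"
    and dist: "distinct (inp @ s @ t)" and range: "set (inp @ s @ t) = {Suc b..n}"
    and sorted: "sorted_wrt (>) s" "sorted_wrt (<) t" "\<forall>x\<in>set s. \<forall>y\<in>set t. x < y"
    and hd_inp: "inp \<noteq> [] \<longrightarrow> (\<forall>y\<in>set t. hd inp < y)"
    and min: "ts \<noteq> [] \<longrightarrow> Suc b \<in> set inp"
    and run: "sorts (spell ts) inp s t" "\<forall>out. adi_from (inp, s, t, out) = spell ts"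
    by blast
  obtain x t' where t: "t = x # t'" using len by (cases t) auto
  have m: "Suc b \<in> set inp" using min 3 by (cases ts) auto
  \<comment> \<open>Before the transfer \<open>x\<close> is on top of the first stack, so the
    condition for \<open>E\<close> fails and the algorithm has to choose \<open>N\<close>.\<close>
  then have x: "hd inp < x" using hd_inp t by auto
  have "\<forall>y\<in>set (x # s) \<union> set t'. Suc b < y"
  proof
    fix y assume y: "y \<in> set (x # s) \<union> set t'"
    then have "y \<in> {Suc b..n}" unfolding range[symmetric] t by auto
    moreover have "y \<noteq> Suc b" using dist m y t by auto
    ultimately show "Suc b < y" by simp
  qed
  then have "adi_from (inp, x # s, t', out) = N # adi_from (inp, s, x # t', out)" for out
    by (rule adi_from_N[OF m]) (use x in auto)
  then have "\<forall>out. adi_from (inp, x # s, t', out) = spell (Transfer # ts)"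
    using run(2) t by simp
  moreover have "sorts (spell (Transfer # ts)) inp (x # s) t'"
    using run(1) sorted(2) t by (auto intro: sorts_N)
  moreover have "length (x # s) = h" "length t' = d" using len t 3(2) by auto
  moreover have "distinct (inp @ (x # s) @ t')" using dist t by auto
  moreover have "set (inp @ (x # s) @ t') = {Suc b..n}" unfolding range[symmetric] t by auto
  moreover have "sorted_wrt (>) (x # s)" "sorted_wrt (<) t'" "\<forall>y\<in>set (x # s). \<forall>z\<in>set t'. y < z"
    using sorted t by auto
  moreover have "inp \<noteq> [] \<longrightarrow> (\<forall>y\<in>set t'. hd inp < y)" using hd_inp t by simp
  ultimately show ?case using m by blast
next
  case (4 k ts)
  \<comment> \<open>\<open>b\<close> values are already output and the block outputs the next
    \<open>k\<close>, so the later configuration uses the values above \<open>b + k\<close>.\<close>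
  have "admissible 0 (Suc d - k) ts" "b + k + 0 + (Suc d - k) + inputs ts = n" using 4(2,3) by auto
  from "4.IH"[OF this] obtain inp t where len: "length t = Suc d - k"
    and dist: "distinct (inp @ t)" and range: "set (inp @ t) = {Suc (b + k)..n}"
    and sorted: "sorted_wrt (<) t"
    and run: "sorts (spell ts) inp [] t" "\<forall>out. adi_from (inp, [], t, out) = spell ts"
    by auto
  \<comment> \<open>Before the block, \<open>x\<close> is the next input entry, and the other
    \<open>k - 1\<close> values that the block outputs lie on top of the second stack.\<close>
  define x where "x = Suc b"
  define t' where "t' = [Suc x..<x + k] @ t"
  have k: "0 < k" "k \<le> Suc d" "h = 0" using 4 by auto
  have xt': "x # t' = [x..<x + k] @ t" using k by (simp add: t'_def upt_conv_Cons del: upt_Suc)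
  have ge: "\<forall>y\<in>set inp \<union> set [] \<union> set t. x + k \<le> y"
  proof
    fix y assume "y \<in> set inp \<union> set [] \<union> set t"
    then have "y \<in> set (inp @ t)" by simp
    then show "x + k \<le> y" unfolding range x_def by simp
  qed
  then have ge_inp: "x + k \<le> y" if "y \<in> set inp" for y using that by simp
  have ge_t: "x + k \<le> y" if "y \<in> set t" for y using ge that by simp
  have x: "\<forall>y\<in>set inp \<union> set t'. x < y"
  proof
    fix y assume "y \<in> set inp \<union> set t'"
    then show "x < y" using bspec[OF ge, of y] k
      by (cases "y \<in> {Suc x..<x + k}") (auto simp: t'_def)
  qed
  have "adi_from (x # inp, [], t', out) = E # N # replicate k C @ spell ts" for out
  proof -
    have "adi_from (x # inp, [], t', out) = E # adi_from (inp, [x], t', out)"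
      by (rule adi_from_E[of x]) (use x in \<open>cases t'; auto\<close>)+
    moreover have "adi_from (inp, [x], t', out) = N # adi_from (inp, [], x # t', out)"
      using x by (rule adi_from_transfer_min)
    ultimately show ?thesis
      using adi_from_replicate_C[OF ge, of out] run(2) by (auto simp: xt')
  qed
  moreover have "sorts (replicate k C @ spell ts) inp [] (x # t')"
    unfolding xt' using run(1) ge by (rule sorts_replicate_C)
  then have "sorts (E # N # replicate k C @ spell ts) (x # inp) [] t'"
    using x by (intro sorts_E sorts_N) auto
  moreover have "length t' = d" using len k by (simp add: t'_def)
  moreover have "distinct (x # inp @ t')" "sorted_wrt (<) t'"
    using dist sorted x by (auto simp: t'_def sorted_wrt_append dest: ge_inp ge_t)
  moreover have "set (x # inp @ t') = {Suc b..n}"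
  proof -
    have "set (x # inp @ t') = {x..<x + k} \<union> set (inp @ t)"
      using arg_cong[OF xt', of set] by auto
    also have "\<dots> = {x..<x + k} \<union> {Suc (b + k)..n}" by (simp only: range)
    also have "\<dots> = {Suc b..n}" using 4(3) k by (auto simp: x_def)
    finally show ?thesis .
  qed
  moreover have "\<forall>y\<in>set t'. x < y" using x by simp
  ultimately show ?case using k(3)
    by (intro exI[of _ "x # inp"] exI[of _ "[]"] exI[of _ t']) (simp add: x_def)
qed

definition token_words :: "nat \<Rightarrow> token list set" where
  "token_words n = {ts. admissible 0 0 ts \<and> inputs ts = n}"

text \<open>Both stacks are empty at the start, so \<open>adi_from_tokens\<close> yields no leading
  \<open>C\<close>'s, and the configuration that \<open>config_of_tokens\<close> gives for
  \<open>b = 0\<close> is a permutation waiting in the input.\<close>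

lemma adi_words_eq: "adi_words n = spell ` token_words n"
proof (intro equalityI subsetI)
  fix W assume "W \<in> adi_words n"
  then obtain p where p: "p \<in> permutations_of_set {1..n}" "di_sortable p" "W = adi_word p"
    by (auto simp: adi_words_def)
  then obtain w where "sorts w p [] []" using di_sortable_iff_sorts by blast
  moreover have "distinct p" "length p = n"
    using p(1) by (auto simp: permutations_of_set_def dest: distinct_card)
  ultimately obtain ts where "adi_from (p, [], [], []) = spell ts" "admissible 0 0 ts" "inputs ts = n"
    using adi_from_tokens[of w p "[]" "[]" "[]"] by auto
  then show "W \<in> spell ` token_words n"
    using p(3) by (auto simp: token_words_def adi_word_def initial_def)
next
  fix W assume "W \<in> spell ` token_words n"
  then obtain ts where ts: "W = spell ts" "admissible 0 0 ts" "inputs ts = n"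
    by (auto simp: token_words_def)
  then obtain p where p: "distinct p" "set p = {1..n}" "sorts (spell ts) p [] []"
    "adi_from (p, [], [], []) = spell ts"
    using config_of_tokens[of 0 0 ts 0 n] by auto
  then have "p \<in> permutations_of_set {1..n}" by (simp add: permutations_of_set_def)
  with p show "W \<in> adi_words n"
    using di_sortable_iff_sorts ts(1)
    by (auto simp: adi_words_def adi_word_def initial_def intro!: image_eqI[of _ _ p])
qed

section \<open>Token sequences and paths\<close>

fun blocks :: "token list \<Rightarrow> nat list" where
  "blocks [] = []"
| "blocks (Block k # ts) = k # blocks ts"
| "blocks (_ # ts) = blocks ts"

fun skeleton :: "token list \<Rightarrow> letter list" where
  "skeleton [] = []"
| "skeleton (Enter # ts) = E # skeleton ts"
| "skeleton (_ # ts) = N # skeleton ts"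

lemma spell_not_C: "admissible h d ts \<Longrightarrow> spell ts \<noteq> C # w"
  by (cases ts rule: spell.cases) auto

lemma takeWhile_dropWhile_replicate_C:
  assumes "\<And>w'. w \<noteq> C # w'"
  shows "takeWhile ((=) C) (replicate k C @ w) = replicate k C"
    "dropWhile ((=) C) (replicate k C @ w) = w"
proof -
  have "takeWhile ((=) C) w = []" "dropWhile ((=) C) w = w" using assms by (cases w; auto)+
  then show "takeWhile ((=) C) (replicate k C @ w) = replicate k C"
    "dropWhile ((=) C) (replicate k C @ w) = w"
    by (induction k) auto
qed

lemma contract_E_N:
  assumes "\<And>w'. w \<noteq> C # w'"
  shows "contract (E # N # w) = E # contract (N # w)"
proof (cases w)
  case (Cons a w')
  with assms[of w'] show ?thesis by (cases a) simp_all
qed simp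

text \<open>Only an \<open>Enter\<close> followed by a \<open>Transfer\<close> could be mistaken for
  a block, but what comes after these two never begins with \<open>C\<close>.\<close>

lemma contract_spell: "admissible h d ts \<Longrightarrow> contract (spell ts) = skeleton ts"
proof (induction ts arbitrary: h d rule: spell.induct)
  case (2 ts)
  have "contract (E # spell ts) = E # contract (spell ts)"
  proof (cases ts rule: spell.cases)
    case (3 ts')
    with 2(2) have "admissible h (Suc d) ts'" by simp
    from contract_E_N[OF spell_not_C[OF this]] show ?thesis unfolding 3 by simp
  qed auto
  with 2 show ?case by auto
next
  case (4 k ts)
  then have ts: "admissible 0 (Suc d - k) ts" by simp
  obtain k' where "k = Suc k'" using 4 by (cases k) auto
  then show ?case
    using takeWhile_dropWhile_replicate_C(2)[of "spell ts" k'] spell_not_C[OF ts] 4(1)[OF ts] by simp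
qed auto

lemma C_blocks_spell: "admissible h d ts \<Longrightarrow> C_blocks (spell ts) = blocks ts"
proof (induction ts arbitrary: h d rule: spell.induct)
  case (4 k ts)
  then have ts: "admissible 0 (Suc d - k) ts" by simp
  obtain k' where "k = Suc k'" using 4 by (cases k) auto
  then show ?case
    using takeWhile_dropWhile_replicate_C[of "spell ts" k'] spell_not_C[OF ts] 4(1)[OF ts] by simp
qed auto

section \<open>Partial sums of the block lengths\<close>

fun ends :: "nat \<Rightarrow> nat list \<Rightarrow> nat set" where
  "ends b [] = {}"
| "ends b (k # ks) = insert (b + k) (ends (b + k) ks)"

text \<open>The offset \<open>b\<close> allows recursion on the list; for \<open>b = 0\<close> this
  is the set in \<open>block_ends\<close>.\<close>

lemma ends_eq: "ends b ks = {b + sum_list (take i ks) | i. 1 \<le> i \<and> i \<le> length ks}"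
proof (induction ks arbitrary: b)
  case (Cons k ks)
  have "{b + sum_list (take i (k # ks)) | i. 1 \<le> i \<and> i \<le> length (k # ks)} =
    (\<lambda>i. b + sum_list (take i (k # ks))) ` {1..Suc (length ks)}" by auto
  also have "{1..Suc (length ks)} = insert 1 (Suc ` {1..length ks})"
    by (auto simp: image_Suc_atLeastAtMost)
  also have "(\<lambda>i. b + sum_list (take i (k # ks))) ` \<dots> =
    insert (b + k) ((\<lambda>i. b + k + sum_list (take i ks)) ` {1..length ks})"
    by (simp add: image_image add.assoc del: image_Suc_atLeastAtMost)
  also have "(\<lambda>i. b + k + sum_list (take i ks)) ` {1..length ks} = ends (b + k) ks"
    unfolding Cons.IH by auto
  finally show ?case by simp
qed simp

lemma Phi_spell:
  assumes "admissible h d ts"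
  shows "Phi (spell ts) = butlast (mark (ends 0 (blocks ts)) 1 (skeleton ts))"
  by (simp add: Phi_def block_ends_def ends_eq contract_spell[OF assms] C_blocks_spell[OF assms])

lemma finite_ends [simp]: "finite (ends b ks)"
  by (induction ks arbitrary: b) auto

lemma ends_greater: "l \<in> ends b ks \<Longrightarrow> 0 \<notin> set ks \<Longrightarrow> b < l"
  by (induction ks arbitrary: b) fastforce+

lemma ends_le: "l \<in> ends b ks \<Longrightarrow> l \<le> b + sum_list ks"
  by (induction ks arbitrary: b) fastforce+

lemma sum_list_in_ends: "ks \<noteq> [] \<Longrightarrow> b + sum_list ks \<in> ends b ks"
proof (induction ks arbitrary: b)
  case (Cons k ks)
  then show ?case using Cons.IH[of "b + k"] by (cases "ks = []") (auto simp: add.assoc)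
qed simp

lemma ends_Cons_le: "l \<in> ends b (k # ks) \<Longrightarrow> 0 \<notin> set ks \<Longrightarrow> b + k \<le> l"
  using ends_greater[of l "b + k" ks] by auto

text \<open>As all later entries are positive, \<open>b + k\<close> is the least element of
  \<open>ends b (k # ks)\<close>; it determines \<open>k\<close> and can be removed from both
  sets.\<close>

lemma ends_inject:
  assumes "ends b ks = ends b ks'" "0 \<notin> set ks" "0 \<notin> set ks'"
  shows "ks = ks'"
  using assms
proof (induction ks arbitrary: b ks')
  case Nil
  then show ?case by (cases ks') auto
next
  case (Cons k ks)
  then obtain k' ks1 where ks': "ks' = k' # ks1" by (cases ks') auto
  have "b + k \<in> ends b (k' # ks1)" "b + k' \<in> ends b (k # ks)" using Cons.prems(1) ks' by auto
  then have "b + k' \<le> b + k" "b + k \<le> b + k'"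
    using ends_Cons_le Cons.prems(2,3) ks' by (metis list.set_intros(2))+
  then have k: "k' = k" by simp
  moreover have "b + k \<notin> ends (b + k) ks" "b + k \<notin> ends (b + k) ks1"
    using ends_greater Cons.prems(2,3) ks' by fastforce+
  ultimately have "ends (b + k) ks = ends (b + k) ks1"
    using Cons.prems(1) ks' by (simp add: insert_ident)
  then show ?case using Cons.IH[of "b + k" ks1] Cons.prems(2,3) ks' k by simp
qed

text \<open>The list consists of the differences of successive elements of \<open>L\<close>,
  starting from \<open>b\<close>.\<close>

lemma ends_exists:
  assumes "finite L" "\<forall>l\<in>L. b < l"
  shows "\<exists>ks. 0 \<notin> set ks \<and> ends b ks = L"
  using assms
proof (induction arbitrary: b rule: finite_linorder_min_induct)
  case empty
  then show ?case by (intro exI[of _ "[]"]) simp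
next
  case (insert m L)
  then obtain ks where "0 \<notin> set ks" "ends m ks = L" by blast
  with insert.prems show ?case by (intro exI[of _ "(m - b) # ks"]) auto
qed

lemma ends_le_start: "0 \<notin> set ks \<Longrightarrow> {l\<in>ends b ks. l \<le> b} = {}"
  using ends_greater by (auto simp flip: not_le)

lemma card_le_Suc:
  fixes A :: "nat set"
  assumes "finite A"
  shows "card {l\<in>A. l \<le> Suc j} = card {l\<in>A. l \<le> j} + (if Suc j \<in> A then 1 else 0)"
proof -
  have "{l\<in>A. l \<le> Suc j} = (if Suc j \<in> A then insert (Suc j) {l\<in>A. l \<le> j} else {l\<in>A. l \<le> j})"
    by (auto simp: le_Suc_eq)
  then show ?thesis using assms by simp
qed

lemma card_ends_Cons:
  assumes "0 \<notin> set ks" "b + k \<le> j"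
  shows "card {l\<in>ends b (k # ks). l \<le> j} = Suc (card {l\<in>ends (b + k) ks. l \<le> j})"
proof -
  have "{l\<in>ends b (k # ks). l \<le> j} = insert (b + k) {l\<in>ends (b + k) ks. l \<le> j}"
    using assms(2) by auto
  moreover have "b + k \<notin> ends (b + k) ks" using ends_greater assms(1) by blast
  ultimately show ?thesis by simp
qed

text \<open>Here \<open>v\<close> is the excess of the abscissa over the ordinate.\<close>

fun below :: "nat \<Rightarrow> letter list \<Rightarrow> bool" where
  "below v [] \<longleftrightarrow> v = 0"
| "below v (E # w) \<longleftrightarrow> below (Suc v) w"
| "below v (N # w) \<longleftrightarrow> v > 0 \<and> below (v - 1) w"
| "below v (D # w) \<longleftrightarrow> below v w"
| "below v (C # w) \<longleftrightarrow> False"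

fun rises :: "letter list \<Rightarrow> nat" where
  "rises [] = 0"
| "rises (a # w) = (if a = N \<or> a = D then Suc (rises w) else rises w)"

lemma rises_append [simp]: "rises (v @ w) = rises v + rises w"
  by (induction v) auto

lemma below_snoc_D [simp]: "below v (w @ [D]) \<longleftrightarrow> below v w"
  by (induction v w rule: below.induct) auto

lemma below_letters: "below v w \<Longrightarrow> set w \<subseteq> {E, N, D}"
  by (induction v w rule: below.induct) auto

text \<open>Only the excess \<open>x - y\<close> matters for staying below the diagonal. It ends at
  zero exactly on the diagonal, and the final height is \<open>y\<close> plus the number of
  \<open>N\<close>'s and \<open>D\<close>'s.\<close>

lemma path_iff_below:
  assumes "y \<le> x"
  shows "set w \<subseteq> {E, N, D} \<and> fold move w (x, y) = (m, m) \<and>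
      (\<forall>k\<le>length w. snd (fold move (take k w) (x, y)) \<le> fst (fold move (take k w) (x, y)))
    \<longleftrightarrow> below (x - y) w \<and> y + rises w = m"
  using assms
proof (induction w arbitrary: x y)
  case (Cons a w)
  show ?case
  proof (cases a)
    case E
    then show ?thesis using Cons.IH[of y "Suc x"] Cons.prems by (simp add: all_le_Suc_iff Suc_diff_le)
  next
    case N
    show ?thesis
    proof (cases "y < x")
      case True
      then show ?thesis using N Cons.IH[of "Suc y" x] by (simp add: all_le_Suc_iff)
    next
      case False
      then show ?thesis using N Cons.prems by (auto simp: all_le_Suc_iff intro!: exI[of _ 0])
    qed
  next
    case D
    then show ?thesis using Cons.IH[of "Suc y" "Suc x"] Cons.prems by (simp add: all_le_Suc_iff)
  next
    case C
    then show ?thesis by simp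
  qed
qed auto

lemma schroeder_paths_iff: "w \<in> schroeder_paths m \<longleftrightarrow> below 0 w \<and> rises w = m"
  using path_iff_below[of 0 0 w m] by (simp add: schroeder_paths_def endpoint_def)

text \<open>If \<open>Suc j\<close> is in \<open>A\<close>, the count grows by one and
  \<open>D\<close> keeps the excess; otherwise the count stays and \<open>N\<close> lowers the
  excess. In terms of the new count both letters subtract one.\<close>

lemma below_rise:
  assumes "finite A"
  shows "below (h + card {l\<in>A. l \<le> j}) ((if Suc j \<in> A then D else N) # w) \<longleftrightarrow>
    0 < h + card {l\<in>A. l \<le> Suc j} \<and> below (h + card {l\<in>A. l \<le> Suc j} - 1) w"
  using card_le_Suc[OF assms, of j] by auto

section \<open>Recovering a word from its marks\<close>

fun D_ranks :: "nat \<Rightarrow> letter list \<Rightarrow> nat set" where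
  "D_ranks j [] = {}"
| "D_ranks j (D # w) = insert j (D_ranks (Suc j) w)"
| "D_ranks j (N # w) = D_ranks (Suc j) w"
| "D_ranks j (_ # w) = D_ranks j w"

definition unmark :: "letter list \<Rightarrow> letter list" where
  "unmark = map (\<lambda>a. if a = D then N else a)"

lemma D_ranks_range: "l \<in> D_ranks j w \<Longrightarrow> j \<le> l \<and> l < j + rises w"
  by (induction j w rule: D_ranks.induct) fastforce+

lemma finite_D_ranks [simp]: "finite (D_ranks j w)"
  by (induction j w rule: D_ranks.induct) auto

lemma mark_cong: "\<forall>l\<ge>j. l \<in> L \<longleftrightarrow> l \<in> L' \<Longrightarrow> mark L j w = mark L' j w"
  by (induction w arbitrary: j) auto

lemma mark_unmark: "mark (D_ranks j w) j (unmark w) = w"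
proof (induction j w rule: D_ranks.induct)
  case (2 j w)
  have "mark (insert j (D_ranks (Suc j) w)) (Suc j) (unmark w) = mark (D_ranks (Suc j) w) (Suc j) (unmark w)"
    by (rule mark_cong) auto
  with 2 show ?case by (simp add: unmark_def)
next
  case (3 j w)
  have "j \<notin> D_ranks (Suc j) w" using D_ranks_range by fastforce
  with 3 show ?case by (simp add: unmark_def)
qed (auto simp: unmark_def)

lemma unmark_mark: "D \<notin> set w \<Longrightarrow> unmark (mark L j w) = w"
  by (induction w arbitrary: j) (auto simp: unmark_def)

text \<open>Elements of \<open>L\<close> that are not ranks in \<open>w\<close> leave no trace in
  the marked word, hence the intersection.\<close>

lemma D_ranks_mark: "D \<notin> set w \<Longrightarrow> D_ranks j (mark L j w) = L \<inter> {j..<j + rises w}"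
proof (induction w arbitrary: j)
  case (Cons a w)
  show ?case
  proof (cases a)
    case N
    have "{j..<j + Suc (rises w)} = insert j {Suc j..<Suc j + rises w}" by auto
    then show ?thesis using N Cons by auto
  qed (use Cons in auto)
qed simp

lemma rises_mark: "rises (mark L j w) = rises w"
  by (induction w arbitrary: j) auto

lemma mark_snoc_N: "D \<notin> set w \<Longrightarrow> mark L j (w @ [N]) = mark L j w @ [if j + rises w \<in> L then D else N]"
  by (induction w arbitrary: j) auto

section \<open>Marked skeletons as paths\<close>

lemma D_notin_skeleton [simp]: "D \<notin> set (skeleton ts)"
  by (induction ts rule: skeleton.induct) auto

lemma rises_skeleton: "admissible h d ts \<Longrightarrow> rises (skeleton ts) = h + inputs ts"
  by (induction h d ts rule: admissible.induct) auto

lemma zero_notin_blocks: "admissible h d ts \<Longrightarrow> 0 \<notin> set (blocks ts)"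
  by (induction h d ts rule: admissible.induct) auto

text \<open>The stacks end up empty, so each value in a stack or still in the input is output
  exactly once.\<close>

lemma sum_list_blocks: "admissible h d ts \<Longrightarrow> sum_list (blocks ts) = h + d + inputs ts"
  by (induction h d ts rule: admissible.induct) auto

lemma skeleton_last: "admissible h d ts \<Longrightarrow> ts \<noteq> [] \<Longrightarrow> \<exists>w. skeleton ts = w @ [N]"
proof (induction h d ts rule: admissible.induct)
  case (2 h d ts)
  then show ?case by (cases ts) auto
next
  case (3 h d ts)
  then show ?case by (cases "ts = []") auto
next
  case (4 h d k ts)
  then show ?case by (cases "ts = []") auto
qed simp

text \<open>The last letter of the skeleton is the \<open>n\<close>-th \<open>N\<close>, and
  \<open>n\<close> is the last block end, so it becomes the \<open>D\<close> that
  \<open>butlast\<close> deletes.\<close>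

lemma mark_skeleton:
  assumes "ts \<in> token_words n" "n > 0"
  shows "mark (ends 0 (blocks ts)) 1 (skeleton ts) = Phi (spell ts) @ [D]"
proof -
  have ts: "admissible 0 0 ts" "inputs ts = n" using assms(1) by (auto simp: token_words_def)
  then have "ts \<noteq> []" using assms(2) by auto
  with ts obtain w where w: "skeleton ts = w @ [N]" using skeleton_last by blast
  have "D \<notin> set w" using D_notin_skeleton[of ts] w by simp
  have "Suc (rises w) = n" using rises_skeleton[OF ts(1)] w ts(2) by simp
  moreover have "n \<in> ends 0 (blocks ts)"
    using sum_list_blocks[OF ts(1)] sum_list_in_ends[of "blocks ts" 0] ts(2) assms(2)
    by (cases "blocks ts = []") auto
  ultimately show ?thesis
    unfolding Phi_spell[OF ts(1)] w by (simp add: mark_snoc_N[OF \<open>D \<notin> set w\<close>])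
qed

text \<open>With \<open>b\<close> values output, \<open>b + d\<close> letters \<open>N\<close> of
  the skeleton have passed; the excess is \<open>h\<close> plus the number of ends up to
  \<open>b + d\<close> of blocks still to come. At a \<open>Block\<close> the next end is at most
  \<open>Suc (b + d)\<close>, so the excess may drop. Agreement with \<open>L\<close> is asked only
  beyond \<open>b + d\<close>, because ends of finished blocks remain in \<open>L\<close>.\<close>

lemma below_mark_skeleton:
  assumes "admissible h d ts" "\<forall>l>b + d. l \<in> L \<longleftrightarrow> l \<in> ends b (blocks ts)"
  shows "below (h + card {l\<in>ends b (blocks ts). l \<le> b + d}) (mark L (Suc (b + d)) (skeleton ts))"
  using assms
proof (induction h d ts arbitrary: b rule: admissible.induct)
  case (3 h d ts)
  have "below (h - 1 + card {l\<in>ends b (blocks ts). l \<le> b + Suc d}) (mark L (Suc (b + Suc d)) (skeleton ts))"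
    by (rule "3.IH") (use 3 in auto)
  moreover have "Suc (b + d) \<in> L \<longleftrightarrow> Suc (b + d) \<in> ends b (blocks ts)" using 3(3) by auto
  ultimately show ?case
    using 3(2) below_rise[OF finite_ends, of h b "blocks ts" "b + d"] by simp
next
  case (4 h d k ts)
  have adm: "h = 0" "0 < k" "k \<le> Suc d" "admissible 0 (Suc d - k) ts" using 4 by auto
  have "below (0 + card {l\<in>ends (b + k) (blocks ts). l \<le> (b + k) + (Suc d - k)})
      (mark L (Suc ((b + k) + (Suc d - k))) (skeleton ts))"
    by (rule "4.IH") (use 4 in auto)
  moreover have "card {l\<in>ends b (blocks (Block k # ts)). l \<le> Suc (b + d)} =
      Suc (card {l\<in>ends (b + k) (blocks ts). l \<le> Suc (b + d)})"
    using card_ends_Cons[OF zero_notin_blocks[OF adm(4)], of b k "Suc (b + d)"] adm by simp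
  moreover have "Suc (b + d) \<in> L \<longleftrightarrow> Suc (b + d) \<in> ends b (blocks (Block k # ts))"
    using 4(3) by auto
  ultimately show ?case
    using adm below_rise[OF finite_ends, of 0 b "blocks (Block k # ts)" "b + d"]
    by (simp del: ends.simps blocks.simps)
qed auto

text \<open>Tokens are read off from the left: \<open>j\<close> rises have passed, so the second
  stack has size \<open>j - b\<close>. A rise is a \<open>Transfer\<close> if \<open>h > 0\<close>
  and otherwise a \<open>Block\<close> with the next length from \<open>ks\<close>.\<close>

lemma tokens_of_below:
  assumes "below (h + card {l\<in>ends b ks. l \<le> j}) S" "\<forall>l>j. l \<in> ends b ks \<longleftrightarrow> l \<in> D_ranks (Suc j) S"
    "0 \<notin> set ks" "b \<le> j" "b + sum_list ks = j + rises S"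
  shows "\<exists>ts. admissible h (j - b) ts \<and> blocks ts = ks \<and> skeleton ts = unmark S"
  using assms
proof (induction S arbitrary: h b ks j)
  case Nil
  \<comment> \<open>Excess zero excludes ends up to \<open>j\<close>, and the absence of further
    \<open>D\<close>'s excludes ends beyond \<open>j\<close>.\<close>
  have "ends b ks = {l\<in>ends b ks. l \<le> j} \<union> {l\<in>ends b ks. j < l}" by auto
  moreover have "{l\<in>ends b ks. l \<le> j} = {}" "{l\<in>ends b ks. j < l} = {}" "h = 0"
    using Nil.prems(1,2) by (auto simp: card_eq_0_iff)
  ultimately have "ks = []" by (cases ks) auto
  then show ?case using Nil.prems(4,5) \<open>h = 0\<close> by (intro exI[of _ "[]"]) (simp add: unmark_def)
next
  case (Cons a S)
  have "a = E \<or> a = N \<or> a = D" using below_letters[OF Cons.prems(1)] by auto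
  then consider (E) "a = E" | (rise) "a = N \<or> a = D" by blast
  then show ?case
  proof cases
    case E
    then obtain ts where "admissible (Suc h) (j - b) ts" "blocks ts = ks" "skeleton ts = unmark S"
      using Cons.IH[of "Suc h" b ks j] Cons.prems by auto
    then show ?thesis using E by (intro exI[of _ "Enter # ts"]) (simp add: unmark_def)
  next
    case rise
    have j: "Suc j \<notin> D_ranks (Suc (Suc j)) S" using D_ranks_range by fastforce
    then have a: "a = (if Suc j \<in> ends b ks then D else N)"
      using rise Cons.prems(2) by auto
    have ranks: "\<forall>l>Suc j. l \<in> ends b ks \<longleftrightarrow> l \<in> D_ranks (Suc (Suc j)) S"
      using Cons.prems(2) rise by auto
    have pos: "0 < h + card {l\<in>ends b ks. l \<le> Suc j}"
      and below: "below (h + card {l\<in>ends b ks. l \<le> Suc j} - 1) S"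
      using Cons.prems(1) below_rise[OF finite_ends, of h b ks j S] a by auto
    have sum: "b + sum_list ks = Suc j + rises S" using Cons.prems(5) rise by auto
    have unmark: "unmark (a # S) = N # unmark S" using rise by (auto simp: unmark_def)
    show ?thesis
    proof (cases "h > 0")
      case True
      then have "below (h - 1 + card {l\<in>ends b ks. l \<le> Suc j}) S" using below by simp
      then obtain ts where "admissible (h - 1) (Suc j - b) ts" "blocks ts = ks" "skeleton ts = unmark S"
        using Cons.IH[OF _ ranks Cons.prems(3) _ sum] Cons.prems(4) by fastforce
      then show ?thesis using True Cons.prems(4)
        by (intro exI[of _ "Transfer # ts"]) (simp add: unmark Suc_diff_le)
    next
      case False
      \<comment> \<open>With \<open>h = 0\<close> the positive count provides an end that is at most
        \<open>Suc j\<close>, so the second stack holds enough values for the next block.\<close>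
      then have "{l\<in>ends b ks. l \<le> Suc j} \<noteq> {}" using pos by force
      then obtain l where l: "l \<in> ends b ks" "l \<le> Suc j" by blast
      then obtain k ks' where ks: "ks = k # ks'" by (cases ks) auto
      have ks': "0 \<notin> set ks'" "0 < k" using Cons.prems(3) ks by auto
      have k: "b + k \<le> Suc j" using ends_Cons_le[of l b k ks'] l ks ks'(1) by simp
      have "below (0 + card {l\<in>ends (b + k) ks'. l \<le> Suc j}) S"
        using below False card_ends_Cons[OF ks'(1) k] ks by simp
      moreover have "\<forall>l>Suc j. l \<in> ends (b + k) ks' \<longleftrightarrow> l \<in> D_ranks (Suc (Suc j)) S"
        using ranks k ks by auto
      moreover have "b + k + sum_list ks' = Suc j + rises S" using sum ks by simp
      ultimately obtain ts where "admissible 0 (Suc j - (b + k)) ts" "blocks ts = ks'"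
        "skeleton ts = unmark S"
        using Cons.IH[of 0 "b + k" ks' "Suc j"] ks'(1) k by blast
      moreover have "Suc (j - b) - k = Suc j - (b + k)" "k \<le> Suc (j - b)"
        using k Cons.prems(4) by auto
      ultimately show ?thesis using False ks ks'(2)
        by (intro exI[of _ "Block k # ts"]) (simp add: unmark)
    qed
  qed
qed

text \<open>\<open>Transfer\<close> and \<open>Block\<close> are told apart by whether the first stack is empty.\<close>

lemma tokens_unique:
  assumes "admissible h d ts" "admissible h d' ts'" "skeleton ts = skeleton ts'" "blocks ts = blocks ts'"
  shows "ts = ts'"
  using assms
proof (induction h d ts arbitrary: d' ts' rule: admissible.induct)
  case (1 h d)
  then show ?case by (cases ts' rule: skeleton.cases) auto
next
  case (2 h d ts)
  then show ?case by (cases ts' rule: spell.cases) auto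
next
  case (3 h d ts)
  then show ?case by (cases ts' rule: spell.cases) auto
next
  case (4 h d k ts)
  then show ?case by (cases ts' rule: spell.cases) auto
qed

section \<open>Bijectivity of \<open>Phi\<close>\<close>

theorem theorem3p7:
  fixes n :: nat
  assumes "n > 0"
  shows "bij_betw Phi (adi_words n) (schroeder_paths (n - 1))"
  unfolding adi_words_eq
proof (rule bij_betw_imageI)
  show "inj_on Phi (spell ` token_words n)"
  proof (rule inj_on_imageI, rule inj_onI)
    fix ts ts' assume ts: "ts \<in> token_words n" "ts' \<in> token_words n"
      and "(Phi \<circ> spell) ts = (Phi \<circ> spell) ts'"
    then have eq: "mark (ends 0 (blocks ts)) 1 (skeleton ts) = mark (ends 0 (blocks ts')) 1 (skeleton ts')"
      using mark_skeleton[OF _ assms] by simp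
    have adm: "admissible 0 0 ts" "admissible 0 0 ts'" using ts by (auto simp: token_words_def)
    \<comment> \<open>All block ends lie between 1 and \<open>n\<close>, so each of them is visible
      as a \<open>D\<close>.\<close>
    have ranks: "D_ranks 1 (mark (ends 0 (blocks us)) 1 (skeleton us)) = ends 0 (blocks us)"
      if "us \<in> token_words n" for us
    proof -
      have us: "admissible 0 0 us" "inputs us = n" using that by (auto simp: token_words_def)
      have "ends 0 (blocks us) \<subseteq> {1..<1 + rises (skeleton us)}"
        using ends_greater[OF _ zero_notin_blocks[OF us(1)], of _ 0] ends_le[of _ 0 "blocks us"]
          sum_list_blocks[OF us(1)] rises_skeleton[OF us(1)] by fastforce
      then show ?thesis by (simp add: D_ranks_mark Int_absorb2)
    qed
    have "skeleton ts = skeleton ts'"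
      using arg_cong[OF eq, of unmark] by (simp add: unmark_mark)
    moreover have "ends 0 (blocks ts) = ends 0 (blocks ts')"
      using ranks[OF ts(1)] ranks[OF ts(2)] eq by simp
    then have "blocks ts = blocks ts'"
      by (rule ends_inject) (use zero_notin_blocks adm in blast)+
    ultimately show "ts = ts'" using tokens_unique[OF adm] by blast
  qed
  show "Phi ` spell ` token_words n = schroeder_paths (n - 1)"
  proof (intro equalityI subsetI)
    fix S assume "S \<in> Phi ` spell ` token_words n"
    then obtain ts where ts: "ts \<in> token_words n" "S = Phi (spell ts)" by blast
    then have adm: "admissible 0 0 ts" "inputs ts = n" by (auto simp: token_words_def)
    let ?L = "ends 0 (blocks ts)"
    have "below (0 + card {l\<in>?L. l \<le> 0 + 0}) (mark ?L (Suc (0 + 0)) (skeleton ts))"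
      by (rule below_mark_skeleton[OF adm(1)]) simp
    then have "below 0 (mark ?L 1 (skeleton ts))"
      unfolding add_0_left ends_le_start[OF zero_notin_blocks[OF adm(1)]] by simp
    then have "below 0 S" unfolding mark_skeleton[OF ts(1) assms] ts(2) by simp
    moreover have "rises (S @ [D]) = n"
      using rises_skeleton[OF adm(1)] adm(2) rises_mark[of ?L 1 "skeleton ts"]
      unfolding mark_skeleton[OF ts(1) assms] ts(2) by simp
    ultimately show "S \<in> schroeder_paths (n - 1)" by (auto simp: schroeder_paths_iff)
  next
    fix S assume S: "S \<in> schroeder_paths (n - 1)"
    \<comment> \<open>This restores the final \<open>D\<close> deleted by
      \<open>Phi\<close>.\<close>
    define S' where "S' = S @ [D]"
    have S': "below 0 S'" "rises S' = n" using S assms by (auto simp: schroeder_paths_iff S'_def)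
    have "\<forall>l\<in>D_ranks 1 S'. 0 < l" using D_ranks_range by fastforce
    then obtain ks where ks: "0 \<notin> set ks" "ends 0 ks = D_ranks 1 S'"
      using ends_exists[OF finite_D_ranks] by blast
    \<comment> \<open>The appended \<open>D\<close> has rank \<open>n\<close>, so \<open>n\<close>
      is a block end; this fixes the sum of the block lengths.\<close>
    have "n \<in> D_ranks j (w @ [D])" if "j + rises w = n" for j w
      using that by (induction j w rule: D_ranks.induct) auto
    then have n: "n \<in> ends 0 ks" using S'(2) by (auto simp: ks(2) S'_def)
    have "sum_list ks = n"
    proof (rule antisym)
      show "n \<le> sum_list ks" using ends_le[OF n] by simp
      have "sum_list ks \<in> ends 0 ks" using sum_list_in_ends[of ks 0] n by (cases ks) auto
      then show "sum_list ks \<le> n" using D_ranks_range[of _ 1 S'] S'(2) ks(2) by fastforce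
    qed
    moreover have "below (0 + card {l\<in>ends 0 ks. l \<le> 0}) S'"
      unfolding ends_le_start[OF ks(1)] using S'(1) by simp
    ultimately obtain ts where "admissible 0 (0 - 0) ts" and ts: "blocks ts = ks" "skeleton ts = unmark S'"
      using tokens_of_below[of 0 0 ks 0 S'] ks S'(2) by auto
    then have adm: "admissible 0 0 ts" by simp
    have "inputs ts = n" using sum_list_blocks[OF adm] ts(1) \<open>sum_list ks = n\<close> by simp
    with adm have tw: "ts \<in> token_words n" by (simp add: token_words_def)
    have "Phi (spell ts) @ [D] = S @ [D]"
      unfolding mark_skeleton[OF tw assms, symmetric] ts ks(2) mark_unmark S'_def ..
    with tw show "S \<in> Phi ` spell ` token_words n" by auto
  qed
qed

end
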